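(* Let $k\ge2$ and $N\ge1$ be integers, let $c_0,\dots,c_N\in\mathbb R$, and set $c_n:=0$ for $n\notin\{0,\dots,N\}$. Let $q:=\left\lceil\frac N{k-1}\right\rceil-1$ and, for $0\le i\le k-1$, let $B_i$ be the $(q+1)\times(q+1)$ matrix whose $(j+1,j'+1)$ entry is $c_{kj+i-j'}$ for $0\le j,j'\le q$. Let $f:\mathbb R\to\mathbb R$ be a function that is null outside $[0,q+1)$, and define $\psi_f:[0,1)\to\mathbb R^{q+1}$ by $$\psi_f(x):=\begin{pmatrix} f(x) \\ f(x+1) \\ \vdots \\ f(x+q) \end{pmatrix}.$$ Then $f$ satisfies $$f(x)=\sum_{n=0}^Nc_nf(kx-n)\quad\text{for all }x\in\mathbb R$$ if and only if $$\psi_f(x)=B_i\,\psi_f(kx-i)\quad\text{for every }0\le i\le k-1\text{ and every }x\in\Big[\frac ik,\frac{i+1}k\Big).$$ *)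

theory Defs
  imports Complex_Main "Jordan_Normal_Form.Matrix"
begin

(* The finite sequence c 0, ..., c N extended by zero to all integer indices:
   the indices k * j + i - j' of the matrices B_i may be negative or exceed N. *)
definition coeff_ext :: "nat \<Rightarrow> (nat \<Rightarrow> real) \<Rightarrow> int \<Rightarrow> real" where
  "coeff_ext N c n = (if 0 \<le> n \<and> n \<le> int N then c (nat n) else 0)"

(* For k >= 2 and N >= 1 the ceiling is at least 1, so nat truncates nothing. *)
definition refine_q :: "nat \<Rightarrow> nat \<Rightarrow> nat" where
  "refine_q k N = nat (\<lceil>real N / (real k - 1)\<rceil> - 1)"

(* mat counts rows and columns from 0, hence the index pair (j, j') here
   is the (j+1, j'+1) entry in one-based counting. *)
definition refine_mat :: "nat \<Rightarrow> nat \<Rightarrow> (nat \<Rightarrow> real) \<Rightarrow> nat \<Rightarrow> real mat" where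
  "refine_mat k N c i =
     mat (refine_q k N + 1) (refine_q k N + 1)
       (\<lambda>(j, j'). coeff_ext N c (int k * int j + int i - int j'))"

(* Only the values of psi_vec q f on [0,1) are meaningful. *)
definition psi_vec :: "nat \<Rightarrow> (real \<Rightarrow> real) \<Rightarrow> real \<Rightarrow> real vec" where
  "psi_vec q f x = vec (q + 1) (\<lambda>j. f (x + real j))"

end

theory Submission
  imports Defs
begin

text \<open>
  Every real number is \<open>x + j\<close> with \<open>j\<close> an integer and \<open>x \<in> [0,1)\<close>; if moreover
  \<open>x \<in> [i/k, (i+1)/k)\<close>, put \<open>t = kx - i \<in> [0,1)\<close>. Then \<open>k(x + j) - n = t + (kj + i - n)\<close>, so
  substituting \<open>j' = kj + i - n\<close> turns the right-hand side of the refinement equation at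
  \<open>x + j\<close> into \<open>\<Sum>j'. c(kj + i - j') f(t + j')\<close>, where only \<open>0 \<le> j' \<le> q\<close> contribute. For
  \<open>0 \<le> j \<le> q\<close> this is row \<open>j\<close> of the matrix equation. For other \<open>j\<close> both sides vanish:
  \<open>kj + i - j' < 0\<close> if \<open>j < 0\<close>, and \<open>kj + i - j' \<ge> (k - 1)(q + 1) + 1 > N\<close> if \<open>j > q\<close>.
\<close>

text \<open>After the substitution \<open>d = m - n\<close>, both sides sum the same function of an
  integer \<open>d\<close>: the left over the window where the coefficient can be nonzero, the right
  over the window where \<open>f (t + d)\<close> can be. It is applied with
  \<open>m = k * j + i\<close>.\<close>

lemma refinement_sum_reindex:
  fixes f :: "real \<Rightarrow> real" and m :: int
  assumes supp: "\<And>x. x \<notin> {0..<real q + 1} \<Longrightarrow> f x = 0"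
    and t: "0 \<le> t" "t < 1"
  shows "(\<Sum>n=0..N. c n * f (t + of_int m - real n)) =
    (\<Sum>j=0..<q + 1. coeff_ext N c (m - int j) * f (t + real j))"
proof -
  define g where "g d = coeff_ext N c (m - d) * f (t + of_int d)" for d :: int
  \<comment> \<open>Hence the sum of \<open>g\<close> over either window equals the sum over their
    intersection.\<close>
  have g0: "g d = 0" if "d \<notin> {m - int N..m} \<inter> {0..int q}" for d
  proof (cases "d \<in> {0..int q}")
    case True
    then have "d < m - int N \<or> d > m"
      using that by auto
    then show ?thesis
      by (auto simp: g_def coeff_ext_def)
  next
    case False
    then have "d \<le> -1 \<or> d \<ge> int q + 1"
      by auto
    \<comment> \<open>The unit gaps matter: since \<open>0 \<le> t < 1\<close>, they give
      \<open>t + d < 0\<close> or \<open>t + d \<ge> q + 1\<close>.\<close>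
    then have "of_int d \<le> (-1 :: real) \<or> of_int d \<ge> real q + 1"
      by linarith
    then have "t + of_int d \<notin> {0..<real q + 1}"
      using t by auto
    then show ?thesis
      by (simp add: g_def supp)
  qed
  have "(\<Sum>n=0..N. c n * f (t + of_int m - real n)) = sum g {m - int N..m}"
    by (rule sum.reindex_bij_witness[where i = "\<lambda>d. nat (m - d)" and j = "\<lambda>n. m - int n"])
       (auto simp: g_def coeff_ext_def algebra_simps)
  also have "\<dots> = sum g ({m - int N..m} \<inter> {0..int q})"
    by (rule sum.mono_neutral_right) (use g0 in auto)
  also have "\<dots> = sum g {0..int q}"
    by (rule sum.mono_neutral_left) (use g0 in auto)
  also have "\<dots> = (\<Sum>j=0..<q + 1. coeff_ext N c (m - int j) * f (t + real j))"
    by (rule sum.reindex_bij_witness[where i = int and j = nat]) (auto simp: g_def)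
  finally show ?thesis .
qed

text \<open>The ceiling gives \<open>N / (k - 1) \<le> q + 1\<close>, because
  \<open>nat z \<ge> z\<close> for every integer \<open>z\<close>; then multiply by
  \<open>k - 1 > 0\<close>. This is where the choice of \<open>q\<close> enters.\<close>

lemma le_refine_q:
  assumes "k \<ge> 2"
  shows "int N \<le> (int k - 1) * (int (refine_q k N) + 1)"
proof -
  have "real N / (real k - 1) \<le> of_int (int (refine_q k N) + 1)"
    unfolding refine_q_def by linarith
  then have "real N \<le> (real k - 1) * of_int (int (refine_q k N) + 1)"
    using assms by (simp add: field_simps)
  also have "\<dots> = of_int ((int k - 1) * (int (refine_q k N) + 1))"
    by simp
  finally show ?thesis
    by linarith
qed

text \<open>Serves the points outside \<open>[0, q + 1)\<close>, on which the matrix equations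
  impose nothing.\<close>

lemma coeff_ext_outside:
  assumes k: "k \<ge> 2" and i: "i < k" and j': "j' \<le> refine_q k N"
    and j: "j < 0 \<or> j > int (refine_q k N)"
  shows "coeff_ext N c (int k * j + int i - int j') = 0"
  using j
proof
  assume "j < 0"
  then have "int k * j \<le> int k * (-1)"
    by (intro mult_left_mono) auto
  then show ?thesis
    using i by (simp add: coeff_ext_def)
next
  assume "j > int (refine_q k N)"
  then have "int k * j \<ge> int k * (int (refine_q k N) + 1)"
    by (intro mult_left_mono) auto
  moreover have "int N \<le> (int k - 1) * (int (refine_q k N) + 1)"
    by (rule le_refine_q[OF k])
  ultimately show ?thesis
    using j' by (simp add: coeff_ext_def algebra_simps)
qed

text \<open>Row by row: with \<open>t = k * x - i\<close>, the argument
  \<open>t + (k * j + i)\<close> is \<open>k * (x + j)\<close>.\<close>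

lemma psi_vec_eq_iff:
  assumes q: "q = refine_q k N"
    and supp: "\<And>x. x \<notin> {0..<real q + 1} \<Longrightarrow> f x = 0"
    and t: "0 \<le> real k * x - real i" "real k * x - real i < 1"
  shows "psi_vec q f x = refine_mat k N c i *\<^sub>v psi_vec q f (real k * x - real i) \<longleftrightarrow>
    (\<forall>j\<le>q. f (x + real j) = (\<Sum>n=0..N. c n * f (real k * (x + real j) - real n)))"
proof -
  let ?t = "real k * x - real i"
  have "(refine_mat k N c i *\<^sub>v psi_vec q f ?t) $ j =
      (\<Sum>n=0..N. c n * f (real k * (x + real j) - real n))" if "j \<le> q" for j
  proof -
    have "(refine_mat k N c i *\<^sub>v psi_vec q f ?t) $ j =
        (\<Sum>j'=0..<q + 1. coeff_ext N c ((int k * int j + int i) - int j') * f (?t + real j'))"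
      using that by (simp add: refine_mat_def psi_vec_def scalar_prod_def flip: q)
    also have "\<dots> = (\<Sum>n=0..N. c n * f (?t + of_int (int k * int j + int i) - real n))"
      by (rule refinement_sum_reindex[OF supp t, symmetric])
    also have "\<dots> = (\<Sum>n=0..N. c n * f (real k * (x + real j) - real n))"
      by (simp add: algebra_simps)
    finally show ?thesis .
  qed
  then show ?thesis
    by (auto simp: vec_eq_iff psi_vec_def refine_mat_def less_Suc_eq_le simp flip: q)
qed

theorem proposition3p1:
  fixes k N q :: nat and c :: "nat \<Rightarrow> real" and f :: "real \<Rightarrow> real"
  assumes "k \<ge> 2" and "N \<ge> 1"
    and "q = refine_q k N"
    and "\<And>x. x \<notin> {0..<real q + 1} \<Longrightarrow> f x = 0"
  shows "(\<forall>x. f x = (\<Sum>n=0..N. c n * f (real k * x - real n))) \<longleftrightarrow>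
    (\<forall>i \<in> {0..k - 1}. \<forall>x \<in> {real i / real k ..< (real i + 1) / real k}.
       psi_vec q f x = refine_mat k N c i *\<^sub>v psi_vec q f (real k * x - real i))"
    (is "?refinement \<longleftrightarrow> ?matrix")
proof
  assume ?refinement
  show ?matrix
  proof (intro ballI)
    fix i x
    assume "x \<in> {real i / real k ..< (real i + 1) / real k}"
    then have "0 \<le> real k * x - real i" "real k * x - real i < 1"
      using assms(1) by (auto simp: field_simps)
    with \<open>?refinement\<close>
    show "psi_vec q f x = refine_mat k N c i *\<^sub>v psi_vec q f (real k * x - real i)"
      by (subst psi_vec_eq_iff[OF assms(3,4)]) blast+
  qed
next
  assume mat: ?matrix
  show ?refinement
  proof
    fix y :: real
    define j where "j = \<lfloor>y\<rfloor>"
    define x where "x = frac y"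
    have y: "y = x + of_int j"
      by (simp add: x_def j_def frac_def)
    have x: "0 \<le> x" "x < 1"
      by (simp_all add: x_def frac_ge_0 frac_lt_1)
    \<comment> \<open>Selects the subinterval \<open>[i/k, (i+1)/k)\<close> of \<open>[0,1)\<close>
      that contains \<open>x\<close>.\<close>
    define i where "i = nat \<lfloor>real k * x\<rfloor>"
    have i_eq: "real i = of_int \<lfloor>real k * x\<rfloor>"
      using x by (simp add: i_def)
    have t: "0 \<le> real k * x - real i" "real k * x - real i < 1"
      unfolding i_eq by linarith+
    have "real k * x < real k"
      using x assms(1) by simp
    with t have i: "i < k"
      by linarith
    show "f y = (\<Sum>n=0..N. c n * f (real k * y - real n))"
    proof (cases "0 \<le> j \<and> j \<le> int q")
      case True
      have "i \<in> {0..k - 1}" "x \<in> {real i / real k ..< (real i + 1) / real k}"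
        using i t assms(1) by (auto simp: field_simps)
      with mat have "psi_vec q f x = refine_mat k N c i *\<^sub>v psi_vec q f (real k * x - real i)"
        by blast
      then have "\<forall>j\<le>q. f (x + real j) = (\<Sum>n=0..N. c n * f (real k * (x + real j) - real n))"
        by (subst (asm) psi_vec_eq_iff[OF assms(3,4) t])
      moreover have "nat j \<le> q" "y = x + real (nat j)"
        using True y by auto
      ultimately show ?thesis
        by metis
    next
      case False
      then have "j \<le> -1 \<or> j \<ge> int q + 1"
        by auto
      then have "of_int j \<le> (-1 :: real) \<or> of_int j \<ge> real q + 1"
        by linarith
      then have "f y = 0"
        using x y by (intro assms(4)) auto
      have "(\<Sum>n=0..N. c n * f (real k * y - real n)) =
          (\<Sum>n=0..N. c n * f ((real k * x - real i) + of_int (int k * j + int i) - real n))"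
        by (simp add: y algebra_simps)
      also have "\<dots> = (\<Sum>j'=0..<q + 1. coeff_ext N c ((int k * j + int i) - int j')
                          * f ((real k * x - real i) + real j'))"
        by (rule refinement_sum_reindex[OF assms(4) t])
      \<comment> \<open>Each summand has a zero coefficient, as row \<open>j\<close> lies outside
        \<open>0..q\<close>.\<close>
      also have "\<dots> = 0"
        using False assms(3) coeff_ext_outside[OF assms(1) i]
        by (intro sum.neutral) auto
      finally show ?thesis
        using \<open>f y = 0\<close> by simp
    qed
  qed
qed

end
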